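(* For one-sided matching with $n$ agents and $n$ items: (i) for any constant $k\ge1$, every deterministic algorithm making at most $k$ value queries per agent has distortion $\Omega(n^{1/k})$ when valuations are unrestricted, and $\Omega(n^{1/(k+1)})$ when valuations are unit-sum; (ii) every deterministic algorithm making at most $o\!\left(\frac{\log n}{\log\log n}\right)$ value queries per agent has distortion $\omega(\log\log n)$. This holds both for unrestricted and for unit-sum valuations.
   Context: One-sided matching: there is a set $N$ of $n$ agents and a set $A$ of $n$ items. Each agent $i$ has a valuation function $v_i:A\to\mathbb{R}_{\ge0}$. Valuations are unrestricted if arbitrary, and unit-sum if $\sum_j v_i(j)=1$ for every $i$. A deterministic algorithm receives the agents' strict rankings consistent with their values, adaptively makes value queries $(i,j)\mapsto v_i(j)$ (a bounded number per agent), and outputs a bijection $Y:N\to A$. Its distortion is the worst case over valuation profiles in the class of $\max_Z\sum_i v_i(z_i)/\sum_i v_i(y_i)$. *)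

theory Defs
  imports "HOL-Analysis.Analysis" "HOL-Combinatorics.Permutations"
begin

text \<open>Agents and items are both {..<n}. A valuation profile is v :: nat => nat => real,
  v i j = value of agent i for item j; normalised to 0 outside {..<n} x {..<n}.
  A ranking profile sigma gives each agent i < n a list of all n items, ordered from
  most to least preferred, consistent with v i (ties broken arbitrarily).\<close>

definition unrestricted_val :: "nat \<Rightarrow> (nat \<Rightarrow> nat \<Rightarrow> real) \<Rightarrow> bool" where
  "unrestricted_val n v \<longleftrightarrow>
     (\<forall>i j. (i < n \<and> j < n \<longrightarrow> 0 \<le> v i j) \<and> (\<not> (i < n \<and> j < n) \<longrightarrow> v i j = 0))"

definition unit_sum_val :: "nat \<Rightarrow> (nat \<Rightarrow> nat \<Rightarrow> real) \<Rightarrow> bool" where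
  "unit_sum_val n v \<longleftrightarrow> unrestricted_val n v \<and> (\<forall>i<n. (\<Sum>j<n. v i j) = 1)"

definition consistent_rankings ::
    "nat \<Rightarrow> (nat \<Rightarrow> nat \<Rightarrow> real) \<Rightarrow> (nat \<Rightarrow> nat list) \<Rightarrow> bool" where
  "consistent_rankings n v \<sigma> \<longleftrightarrow>
     (\<forall>i<n. distinct (\<sigma> i) \<and> set (\<sigma> i) = {..<n} \<and>
             sorted_wrt (\<lambda>a b. v i b \<le> v i a) (\<sigma> i)) \<and>
     (\<forall>i\<ge>n. \<sigma> i = [])"

definition profiles ::
    "nat \<Rightarrow> (nat \<Rightarrow> (nat \<Rightarrow> nat \<Rightarrow> real) \<Rightarrow> bool) \<Rightarrow>
     ((nat \<Rightarrow> nat \<Rightarrow> real) \<times> (nat \<Rightarrow> nat list)) set" where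
  "profiles n cls = {(v, \<sigma>). cls n v \<and> consistent_rankings n v \<sigma>}"

text \<open>A deterministic adaptive query algorithm: given the rankings and the transcript
  of (query, answer) pairs so far, it either asks the next value query (i,j) or stops
  (None); the output assignment is computed from rankings and final transcript.\<close>
type_synonym transcript = "((nat \<times> nat) \<times> real) list"
type_synonym query_rule = "(nat \<Rightarrow> nat list) \<Rightarrow> transcript \<Rightarrow> (nat \<times> nat) option"
type_synonym output_rule = "(nat \<Rightarrow> nat list) \<Rightarrow> transcript \<Rightarrow> (nat \<Rightarrow> nat)"

fun run :: "query_rule \<Rightarrow> (nat \<Rightarrow> nat list) \<Rightarrow> (nat \<Rightarrow> nat \<Rightarrow> real) \<Rightarrow> nat \<Rightarrow> transcript" where
  "run qry \<sigma> v 0 = []"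
| "run qry \<sigma> v (Suc m) =
     (let t = run qry \<sigma> v m in
      case qry \<sigma> t of None \<Rightarrow> t | Some (i, j) \<Rightarrow> t @ [((i, j), v i j)])"

definition num_queries :: "transcript \<Rightarrow> nat \<Rightarrow> nat" where
  "num_queries t i = length (filter (\<lambda>e. fst (fst e) = i) t)"

text \<open>Final transcript: with at most k queries per agent (all in range) the run has
  stopped after k*n steps.\<close>
definition final_transcript ::
    "nat \<Rightarrow> nat \<Rightarrow> query_rule \<Rightarrow> (nat \<Rightarrow> nat list) \<Rightarrow> (nat \<Rightarrow> nat \<Rightarrow> real) \<Rightarrow> transcript" where
  "final_transcript n k qry \<sigma> v = run qry \<sigma> v (k * n)"

definition alg_output ::
    "nat \<Rightarrow> nat \<Rightarrow> query_rule \<Rightarrow> output_rule \<Rightarrow> (nat \<Rightarrow> nat list) \<Rightarrow> (nat \<Rightarrow> nat \<Rightarrow> real) \<Rightarrow> (nat \<Rightarrow> nat)" where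
  "alg_output n k qry outp \<sigma> v = outp \<sigma> (final_transcript n k qry \<sigma> v)"

definition valid_alg ::
    "nat \<Rightarrow> (nat \<Rightarrow> (nat \<Rightarrow> nat \<Rightarrow> real) \<Rightarrow> bool) \<Rightarrow> nat \<Rightarrow> query_rule \<Rightarrow> output_rule \<Rightarrow> bool" where
  "valid_alg n cls k qry outp \<longleftrightarrow>
     (\<forall>(v, \<sigma>) \<in> profiles n cls.
        (\<forall>m. (\<forall>e\<in>set (run qry \<sigma> v m). fst (fst e) < n \<and> snd (fst e) < n) \<and>
             (\<forall>i. num_queries (run qry \<sigma> v m) i \<le> k)) \<and>
        bij_betw (alg_output n k qry outp \<sigma> v) {..<n} {..<n})"

definition social_welfare :: "nat \<Rightarrow> (nat \<Rightarrow> nat \<Rightarrow> real) \<Rightarrow> (nat \<Rightarrow> nat) \<Rightarrow> real" where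
  "social_welfare n v Y = (\<Sum>i<n. v i (Y i))"

definition opt_welfare :: "nat \<Rightarrow> (nat \<Rightarrow> nat \<Rightarrow> real) \<Rightarrow> real" where
  "opt_welfare n v = Max (social_welfare n v ` {Z. Z permutes {..<n}})"

definition welfare_ratio :: "real \<Rightarrow> real \<Rightarrow> ereal" where
  "welfare_ratio opt sw =
     (if sw = 0 then (if opt = 0 then 1 else \<infinity>) else ereal (opt / sw))"

definition distortion ::
    "nat \<Rightarrow> (nat \<Rightarrow> (nat \<Rightarrow> nat \<Rightarrow> real) \<Rightarrow> bool) \<Rightarrow> nat \<Rightarrow> query_rule \<Rightarrow> output_rule \<Rightarrow> ereal" where
  "distortion n cls k qry outp =
     (SUP p \<in> profiles n cls.
        welfare_ratio (opt_welfare n (fst p))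
          (social_welfare n (fst p) (alg_output n k qry outp (snd p) (fst p))))"

end

theory Submission
  imports Defs "HOL-Real_Asymp.Real_Asymp"
begin

text \<open>
  The adversary splits the items of interest to an agent into levels \<open>l = 0, \<dots>, k\<close> of
  size \<open>r\<^sup>l\<close> and answers a query at level \<open>l < k\<close> by \<open>X / r\<^sup>l\<^sup>+\<^sup>1\<close>. An agent answering \<open>k\<close> queries
  leaves one of the \<open>k + 1\<close> levels unseen, and there its value may be raised to \<open>X / r\<^sup>l\<close>. By
  pigeonhole, one level \<open>l\<close> is unseen for at least \<open>2 r\<^sup>k\<close> agents, so \<open>r\<^sup>l\<close> of them receive no item
  of this level; raising their values lets the optimum gain \<open>X\<close> on that level, while the
  algorithm earns at most \<open>X / r\<close> on each level. One such gadget uses about \<open>r\<^sup>k\<close>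
  agents, up to factors depending on \<open>k\<close>, and settles the unrestricted case.

  In the unit-sum case the normalisation forces \<open>X \<le> 1\<close>, so \<open>r\<close> disjoint gadgets are used side by side
  to outweigh the constant welfare that \<open>n\<close> normalised agents always collect. Below its gadget
  each agent ranks \<open>k + 1\<close> dummy levels, with answers decreasing in steps of \<open>\<delta>\<close>; one of them
  is also unseen, and shifting its value within a window of width \<open>\<delta>\<close> restores the unit sum.
\<close>

section \<open>Answering queries without fixing the profile in advance\<close>

text \<open>Only the entries asked in the run on \<open>b\<close> matter: as long as the answers
  agree, the rule sees the same transcript and asks the same next query.\<close>

lemma run_cong:
  assumes "\<And>a. a \<in> fst ` set (run qry \<sigma> b m) \<Longrightarrow> v (fst a) (snd a) = b (fst a) (snd a)"
  shows "run qry \<sigma> v m = run qry \<sigma> b m"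
  using assms
proof (induction m)
  case (Suc m)
  have "run qry \<sigma> v m = run qry \<sigma> b m"
    using Suc by (force simp: Let_def split: option.splits)
  with Suc.prems show ?case
    by (auto simp: Let_def split: option.splits)
qed simp

text \<open>A query may be repeated, so the budget only bounds the number of distinct items seen,
  which is what the pigeonhole over levels needs.\<close>

lemma card_queries_le_num_queries:
  "card {j. (i, j) \<in> fst ` set t} \<le> num_queries t i"
proof -
  have "{j. (i, j) \<in> fst ` set t} = (\<lambda>e. snd (fst e)) ` set (filter (\<lambda>e. fst (fst e) = i) t)"
    by force
  then show ?thesis
    unfolding num_queries_def by (metis card_length list.set_map length_map)
qed

text \<open>The answers \<open>b\<close> need not form a profile of the class: it is enough that every
  set of at most \<open>k\<close> answers per agent extends to one.\<close>

lemma oblivious_answers: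
  assumes valid: "valid_alg n cls k qry outp"
    and extend: "\<And>Q. (\<And>i. finite {j. (i, j) \<in> Q} \<and> card {j. (i, j) \<in> Q} \<le> k) \<Longrightarrow>
      \<exists>v. (v, \<sigma>) \<in> profiles n cls \<and> (\<forall>(i, j) \<in> Q. v i j = b i j)"
  obtains Q Y where
    "\<And>i. finite {j. (i, j) \<in> Q} \<and> card {j. (i, j) \<in> Q} \<le> k" "bij_betw Y {..<n} {..<n}"
    "\<And>v. (\<forall>(i, j) \<in> Q. v i j = b i j) \<Longrightarrow> alg_output n k qry outp \<sigma> v = Y"
proof -
  define Q where "Q m = fst ` set (run qry \<sigma> b m)" for m
  have fin: "finite {j. (i, j) \<in> Q m}" for i m
    by (rule finite_subset[of _ "snd ` Q m"]) (force simp: Q_def)+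
  have same: "run qry \<sigma> v m = run qry \<sigma> b m" if "\<forall>(i, j) \<in> Q m. v i j = b i j" for v m
    by (rule run_cong) (use that in \<open>auto simp: Q_def\<close>)
  have extend_run: "\<exists>v. (v, \<sigma>) \<in> profiles n cls \<and> (\<forall>(i, j) \<in> Q m. v i j = b i j)"
    if "\<And>i. num_queries (run qry \<sigma> b m) i \<le> k" for m
    using extend[of "Q m"] fin[of _ m] that card_queries_le_num_queries[of _ "run qry \<sigma> b m"]
    unfolding Q_def by (meson le_trans)
  \<comment> \<open>A run of \<open>m\<close> steps within the budget extends to a genuine profile
    \<open>v\<close>, and validity on \<open>v\<close> bounds the run of \<open>Suc m\<close> steps.
    The query in the last step is the same on \<open>b\<close> and on \<open>v\<close>; its answer
    may differ, but the counts do not.\<close>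
  have bound: "num_queries (run qry \<sigma> b m) i \<le> k" for m i
  proof (induction m arbitrary: i)
    case (Suc m)
    obtain v where v: "(v, \<sigma>) \<in> profiles n cls" "\<forall>(i, j) \<in> Q m. v i j = b i j"
      using extend_run Suc by blast
    have "num_queries (run qry \<sigma> v (Suc m)) i \<le> k"
      using valid v(1) unfolding valid_alg_def by blast
    moreover have "num_queries (run qry \<sigma> b (Suc m)) i = num_queries (run qry \<sigma> v (Suc m)) i"
      using same[OF v(2)] by (auto simp: num_queries_def Let_def split: option.splits)
    ultimately show ?case by simp
  qed (simp add: num_queries_def)
  define Y where "Y = outp \<sigma> (run qry \<sigma> b (k * n))"
  have out: "alg_output n k qry outp \<sigma> v = Y" if "\<forall>(i, j) \<in> Q (k * n). v i j = b i j" for v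
    using same[OF that] by (simp add: alg_output_def final_transcript_def Y_def)
  obtain v where v: "(v, \<sigma>) \<in> profiles n cls" "\<forall>(i, j) \<in> Q (k * n). v i j = b i j"
    using extend_run bound by blast
  have "bij_betw (alg_output n k qry outp \<sigma> v) {..<n} {..<n}"
    using valid v(1) unfolding valid_alg_def by blast
  then have "bij_betw Y {..<n} {..<n}"
    using out[OF v(2)] by simp
  moreover have "card {j. (i, j) \<in> Q (k * n)} \<le> k" for i
    using bound card_queries_le_num_queries unfolding Q_def by (meson le_trans)
  ultimately show ?thesis
    using that[of "Q (k * n)" Y] fin out by blast
qed

section \<open>Bounds on the optimum and on the distortion\<close>

text \<open>A partial matching extends to a permutation of \<open>{..<n}\<close>, because as many
  agents as items are left over, and nonnegative values make the additional pairs harmless.\<close>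

lemma opt_welfare_ge:
  assumes "inj_on g T" "T \<subseteq> {..<n}" "g ` T \<subseteq> {..<n}"
    and nonneg: "\<And>i j. 0 \<le> v i j"
  shows "(\<Sum>i\<in>T. v i (g i)) \<le> opt_welfare n v"
proof -
  have finT: "finite T" using assms(2) finite_subset by blast
  have "card ({..<n} - T) = card ({..<n} - g ` T)"
    using assms finT by (simp add: card_Diff_subset card_image)
  then obtain g' where g': "bij_betw g' ({..<n} - T) ({..<n} - g ` T)"
    using finite_same_card_bij[of "{..<n} - T" "{..<n} - g ` T"] by auto
  define Z where "Z i = (if i \<in> T then g i else if i < n then g' i else i)" for i
  have "bij_betw Z T (g ` T)"
    using assms(1) by (auto simp: bij_betw_def Z_def inj_on_def)
  moreover have "bij_betw Z ({..<n} - T) ({..<n} - g ` T)"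
    using g' by (subst bij_betw_cong[of _ Z g']) (auto simp: Z_def)
  ultimately have "bij_betw Z (T \<union> ({..<n} - T)) (g ` T \<union> ({..<n} - g ` T))"
    by (rule bij_betw_combine) auto
  moreover have "T \<union> ({..<n} - T) = {..<n}" "g ` T \<union> ({..<n} - g ` T) = {..<n}"
    using assms by auto
  ultimately have "bij_betw Z {..<n} {..<n}" by simp
  then have Z: "Z permutes {..<n}"
    by (rule bij_imp_permutes) (use assms(2) in \<open>auto simp: Z_def\<close>)
  have "(\<Sum>i\<in>T. v i (g i)) = (\<Sum>i\<in>T. v i (Z i))" by (simp add: Z_def)
  also have "\<dots> \<le> social_welfare n v Z"
    unfolding social_welfare_def using assms(2) nonneg by (intro sum_mono2) auto
  also have "\<dots> \<le> opt_welfare n v"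
    unfolding opt_welfare_def using Z by (intro Max_ge) (auto simp: finite_permutations)
  finally show ?thesis .
qed

text \<open>If the algorithm has welfare 0, the ratio is infinite because \<open>0 < A\<close>
  forces a positive optimum; otherwise the fractions compare directly.\<close>

lemma distortion_ge:
  assumes "(v, \<sigma>) \<in> profiles n cls" "A \<le> opt_welfare n v" "0 < A"
    and "social_welfare n v (alg_output n k qry outp \<sigma> v) \<le> s"
    and "0 \<le> social_welfare n v (alg_output n k qry outp \<sigma> v)"
  shows "ereal (A / s) \<le> distortion n cls k qry outp"
proof -
  let ?w = "social_welfare n v (alg_output n k qry outp \<sigma> v)"
  have "ereal (A / s) \<le> welfare_ratio (opt_welfare n v) ?w"
    using assms by (auto simp: welfare_ratio_def intro!: frac_le)
  also have "\<dots> \<le> distortion n cls k qry outp"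
    unfolding distortion_def using assms(1) by (intro SUP_upper2[of "(v, \<sigma>)"]) auto
  finally show ?thesis .
qed

section \<open>Item blocks of prescribed sizes, and the hard instance built from them\<close>

text \<open>The disjoint union of the blocks has at most \<open>n\<close> elements, so it injects
  into the items; items outside the image stay unlabelled.\<close>

lemma labelling_exists:
  fixes f :: "'a \<Rightarrow> nat"
  assumes "finite I" "sum f I \<le> n"
  obtains lab :: "nat \<Rightarrow> 'a option" where
    "\<And>j x. lab j = Some x \<Longrightarrow> x \<in> I" "\<And>x. x \<in> I \<Longrightarrow> card {j. j < n \<and> lab j = Some x} = f x"
proof -
  define P where "P = (SIGMA x:I. {..<f x})"
  have "card P \<le> card {..<n}" "finite P" using assms by (simp_all add: P_def)
  then obtain e where e: "e ` P \<subseteq> {..<n}" "inj_on e P"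
    using card_le_inj[of P "{..<n}"] by auto
  define lab where "lab j = (if j \<in> e ` P then Some (fst (inv_into P e j)) else None)" for j
  have "{j. j < n \<and> lab j = Some x} = e ` ({x} \<times> {..<f x})" if "x \<in> I" for x
  proof -
    have lab_e: "lab (e a) = Some (fst a)" if "a \<in> P" for a
      using that e by (simp add: lab_def)
    show ?thesis
    proof (intro equalityI subsetI)
      fix j assume j: "j \<in> {j. j < n \<and> lab j = Some x}"
      then obtain a where a: "a \<in> P" "j = e a" by (auto simp: lab_def split: if_splits)
      with j lab_e[OF a(1)] have "a \<in> {x} \<times> {..<f x}" by (auto simp: P_def)
      then show "j \<in> e ` ({x} \<times> {..<f x})" using a(2) by blast
    next
      fix j assume "j \<in> e ` ({x} \<times> {..<f x})"
      then obtain a where a: "a \<in> {x} \<times> {..<f x}" "j = e a" by blast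
      then have "a \<in> P" using that by (auto simp: P_def)
      then show "j \<in> {j. j < n \<and> lab j = Some x}" using a lab_e e(1) by auto
    qed
  qed
  moreover have "card (e ` ({x} \<times> {..<f x})) = f x" if "x \<in> I" for x
    using that e(2) by (subst card_image) (auto simp: P_def intro: inj_on_subset)
  moreover have "x \<in> I" if "lab j = Some x" for j x
    using that inv_into_into[of j e P] by (auto simp: lab_def P_def split: if_splits)
  ultimately show ?thesis using that[of lab] by simp
qed

lemma sum_over_labels:
  fixes F :: "'a \<Rightarrow> real" and n :: nat
  assumes "finite I" "\<And>j x. lab j = Some x \<Longrightarrow> x \<in> I"
  shows "(\<Sum>j<n. case lab j of Some x \<Rightarrow> F x | None \<Rightarrow> 0)
    = (\<Sum>x\<in>I. card {j. j < n \<and> lab j = Some x} * F x)"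
proof -
  have "(\<Sum>j<n. case lab j of Some x \<Rightarrow> F x | None \<Rightarrow> 0)
      = (\<Sum>j<n. \<Sum>x\<in>I. if lab j = Some x then F x else 0)"
  proof (rule sum.cong)
    fix j assume "j \<in> {..<n}"
    show "(case lab j of Some x \<Rightarrow> F x | None \<Rightarrow> 0) = (\<Sum>x\<in>I. if lab j = Some x then F x else 0)"
      using assms by (cases "lab j") auto
  qed simp
  also have "\<dots> = (\<Sum>x\<in>I. \<Sum>j<n. if lab j = Some x then F x else 0)"
    by (rule sum.swap)
  also have "\<dots> = (\<Sum>x\<in>I. card {j. j < n \<and> lab j = Some x} * F x)"
  proof (rule sum.cong)
    fix x assume "x \<in> I"
    have "(\<Sum>j<n. if lab j = Some x then F x else 0)
        = (\<Sum>j\<in>{j\<in>{..<n}. lab j = Some x}. F x)"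
      by (rule sum.inter_filter[symmetric]) simp
    then show "(\<Sum>j<n. if lab j = Some x then F x else 0) = card {j. j < n \<and> lab j = Some x} * F x"
      by simp
  qed simp
  finally show ?thesis .
qed

text \<open>Label \<open>(c, l)\<close> with \<open>c < R\<close> is level \<open>l\<close> of cluster \<open>c\<close>; label \<open>(R, l)\<close> is the \<open>l\<close>-th dummy level.
  Agent \<open>i\<close> is interested in cluster \<open>i mod R\<close>.\<close>

locale level_instance =
  fixes n k r R h :: nat and X \<delta> :: real and lab :: "nat \<Rightarrow> (nat \<times> nat) option"
  assumes r: "1 \<le> r" and R: "1 \<le> R" and X: "0 < X" and \<delta>: "0 \<le> \<delta>"
    and tail: "Suc k * \<delta> \<le> X / r ^ k"
    and lab_range: "\<And>j x. lab j = Some x \<Longrightarrow> x \<in> {..R} \<times> {..k}"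
    and card_lab: "\<And>c l. c \<le> R \<Longrightarrow> l \<le> k \<Longrightarrow>
      card {j. j < n \<and> lab j = Some (c, l)} = (if c < R then r ^ l else h)"
    and large: "2 * Suc k * R * r ^ k \<le> n"
begin

text \<open>One scale per agent: its own cluster takes levels \<open>0\<close> to \<open>k\<close>,
  the dummies \<open>Suc k\<close> to \<open>2 * k + 1\<close>, and everything else, foreign
  clusters included, comes last. Ranking and values depend on an item only through this
  number.\<close>

definition level :: "nat \<Rightarrow> nat \<Rightarrow> nat" where
  "level i j = (case lab j of None \<Rightarrow> 2 * k + 2 | Some (c, l) \<Rightarrow>
     if c = i mod R then l else if c = R then Suc k + l else 2 * k + 2)"

text \<open>Independent of the later choice of raised and shifted levels, so the rankings reveal
  nothing about that choice.\<close>

definition ranking :: "nat \<Rightarrow> nat list" where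
  "ranking i = (if i < n then sort_key (level i) [0..<n] else [])"

text \<open>In the second case the subtraction truncates, so the last dummy level and the
  irrelevant items at level \<open>2 * k + 2\<close> both have value 0.\<close>

definition base :: "nat \<Rightarrow> real" where
  "base L = (if L < k then X / r ^ Suc L else real (2 * k + 1 - L) * \<delta>)"

text \<open>\<open>u\<close> is the level raised to its maximum, if any; the dummy level \<open>s\<close> is shifted by \<open>y\<close>.\<close>

definition level_value :: "nat option \<Rightarrow> nat \<Rightarrow> real \<Rightarrow> nat \<Rightarrow> real" where
  "level_value u s y L =
    (if u = Some L then X / r ^ L else if L = Suc k + s then base L + y else base L)"

definition profile ::
    "(nat \<Rightarrow> nat option) \<Rightarrow> (nat \<Rightarrow> nat) \<Rightarrow> (nat \<Rightarrow> real) \<Rightarrow> nat \<Rightarrow> nat \<Rightarrow> real" where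
  "profile u s y i j = (if i < n \<and> j < n then level_value (u i) (s i) (y i) (level i j) else 0)"

section \<open>Values decrease along the levels\<close>

lemma mod_R_less [simp]: "i mod R < R"
  using R by simp

lemma base_nonneg: "0 \<le> base L"
  using X \<delta> by (simp add: base_def)

lemma level_value_nonneg: "0 \<le> y \<Longrightarrow> 0 \<le> level_value u s y L"
  using X base_nonneg[of L] by (auto simp: level_value_def)

text \<open>The critical place is the passage from level \<open>k - 1\<close> to level
  \<open>k\<close>, where the geometric values meet the multiples of \<open>\<delta>\<close>; there
  the claim is the assumption \<open>tail\<close>.\<close>

lemma base_Suc_le: "base (Suc L) \<le> base L"
proof -
  have r1: "1 \<le> real r" using r by simp
  consider "Suc L < k" | "Suc L = k" | "k \<le> L" by linarith
  then show ?thesis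
  proof cases
    case 1
    have "real r ^ Suc L \<le> real r ^ Suc (Suc L)"
      using r1 by (intro power_increasing) auto
    then show ?thesis
      using 1 X r1 by (simp add: base_def) (intro divide_left_mono; simp)
  next
    case 2
    then have "2 * k + 1 - k = Suc k" by simp
    then show ?thesis using 2 tail by (auto simp: base_def)
  next
    case 3
    then show ?thesis using \<delta> by (auto simp: base_def intro!: mult_right_mono)
  qed
qed

text \<open>A level raised to its maximum \<open>X / r ^ L\<close> just ties with the base value of
  the level before it, and a dummy level shifted by at most \<open>\<delta>\<close> at most closes
  the gap of \<open>\<delta>\<close> to its predecessor. Hence neither change violates the
  ranking.\<close>

lemma level_value_antimono:
  assumes "\<And>l. u = Some l \<Longrightarrow> l \<le> k" "0 \<le> y" "y \<le> \<delta>" "s \<le> k" "L \<le> L'"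
  shows "level_value u s y L' \<le> level_value u s y L"
proof -
  have r1: "1 \<le> real r" using r by simp
  have "level_value u s y (Suc L) \<le> level_value u s y L" for L
  proof -
    have raised: "base (Suc L) + y \<le> base L" if "Suc L = Suc k + s"
    proof -
      have "real (2 * k + 1 - L) = real (2 * k + 1 - Suc L) + 1"
        using that assms(4) by linarith
      then show ?thesis
        using that assms(3) by (simp add: base_def algebra_simps)
    qed
    consider "u = Some L" | "u = Some (Suc L)" | "u \<noteq> Some L" "u \<noteq> Some (Suc L)" by blast
    then show ?thesis
    proof cases
      case 1
      then have Lk: "L \<le> k" using assms(1) by simp
      have "base L \<le> X / r ^ L"
      proof (cases "L < k")
        case True
        have "X / real r ^ Suc L \<le> X / real r ^ L"
          using r1 X by (intro divide_left_mono power_increasing) auto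
        then show ?thesis using True by (simp add: base_def)
      next
        case False
        then have "L = k" "2 * k + 1 - k = Suc k" using Lk by auto
        then show ?thesis using tail by (simp add: base_def)
      qed
      then show ?thesis
        using 1 raised base_Suc_le[of L] by (cases "Suc L = Suc k + s") (auto simp: level_value_def)
    next
      case 2
      then have "L < k" using assms(1) by force
      then show ?thesis using 2 by (simp add: level_value_def base_def)
    next
      case 3
      then show ?thesis
        using raised base_Suc_le[of L] assms(2) by (auto simp: level_value_def)
    qed
  qed
  then show ?thesis
    by (rule lift_Suc_antimono_le) (rule assms)
qed

lemma consistent_ranking:
  assumes "\<And>i l. u i = Some l \<Longrightarrow> l \<le> k" "\<And>i. 0 \<le> y i \<and> y i \<le> \<delta>" "\<And>i. s i \<le> k"
  shows "consistent_rankings n (profile u s y) ranking"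
proof -
  have "sorted_wrt (\<lambda>a b. profile u s y i b \<le> profile u s y i a) (ranking i)" if "i < n" for i
  proof -
    have "sorted_wrt (\<lambda>a b. level i a \<le> level i b) (ranking i)"
      using sorted_sort_key[of "level i" "[0..<n]"] that
      by (simp add: ranking_def sorted_map)
    then show ?thesis
      by (rule sorted_wrt_mono_rel[rotated])
        (use that assms in \<open>auto simp: profile_def ranking_def intro!: level_value_antimono\<close>)
  qed
  then show ?thesis
    by (auto simp: consistent_rankings_def ranking_def)
qed

section \<open>Pigeonhole inside a cluster\<close>

lemma level_eq_iff: "l \<le> k \<Longrightarrow> level i j = l \<longleftrightarrow> lab j = Some (i mod R, l)"
  using lab_range[of j] by (auto simp: level_def split: option.splits)

lemma card_cluster_agents: "n div R \<le> card {i. i < n \<and> i mod R = c}" if "c < R"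
proof -
  have "(\<lambda>q. c + R * q) ` {..<n div R} \<subseteq> {i. i < n \<and> i mod R = c}"
  proof clarsimp
    fix q assume "q < n div R"
    then have "R * Suc q \<le> R * (n div R)" by (intro mult_le_mono2) simp
    also have "\<dots> \<le> n" by simp
    finally show "c + R * q < n \<and> c mod R = c" using that by simp
  qed
  then have "card ((\<lambda>q. c + R * q) ` {..<n div R}) \<le> card {i. i < n \<and> i mod R = c}"
    by (intro card_mono) auto
  moreover have "inj_on (\<lambda>q. c + R * q) {..<n div R}"
    using R by (auto simp: inj_on_def)
  ultimately show ?thesis by (simp add: card_image)
qed

text \<open>Pigeonhole inside one cluster: some level is missed by at least \<open>2 * r ^ k\<close> of its agents,
  and only \<open>r ^ l \<le> r ^ k\<close> of these can receive an item of that level.\<close>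

lemma popular_missed_level:
  assumes "c < R" "\<And>i. m i \<le> k" and inj: "inj_on Y {..<n}" "Y ` {..<n} \<subseteq> {..<n}"
  shows "\<exists>l\<le>k. r ^ l \<le> card {i. i < n \<and> i mod R = c \<and> m i = l \<and> lab (Y i) \<noteq> Some (c, l)}"
proof (rule ccontr)
  assume neg: "\<not> ?thesis"
  let ?A = "{i. i < n \<and> i mod R = c}"
  have "card {i \<in> ?A. m i = l} < 2 * r ^ k" if "l \<le> k" for l
  proof -
    have "{i \<in> ?A. m i = l} \<subseteq> {i. i < n \<and> i mod R = c \<and> m i = l \<and> lab (Y i) \<noteq> Some (c, l)}
        \<union> {i. i < n \<and> lab (Y i) = Some (c, l)}" by auto
    then have "card {i \<in> ?A. m i = l}
        \<le> card ({i. i < n \<and> i mod R = c \<and> m i = l \<and> lab (Y i) \<noteq> Some (c, l)}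
        \<union> {i. i < n \<and> lab (Y i) = Some (c, l)})"
      by (intro card_mono) auto
    also have "\<dots> \<le> card {i. i < n \<and> i mod R = c \<and> m i = l \<and> lab (Y i) \<noteq> Some (c, l)}
        + card {i. i < n \<and> lab (Y i) = Some (c, l)}"
      by (rule card_Un_le)
    also have "card {i. i < n \<and> lab (Y i) = Some (c, l)} \<le> card {j. j < n \<and> lab j = Some (c, l)}"
      using inj by (intro card_inj_on_le[of Y]) (auto intro: inj_on_subset)
    also have "\<dots> = r ^ l" using card_lab that assms(1) by simp
    finally have "card {i \<in> ?A. m i = l} < 2 * r ^ l" using neg that by fastforce
    also have "\<dots> \<le> 2 * r ^ k" using that r by (simp add: power_increasing)
    finally show ?thesis .
  qed
  then have "(\<Sum>l\<le>k. card {i \<in> ?A. m i = l}) < (\<Sum>l\<le>k. 2 * r ^ k)"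
    by (intro sum_strict_mono) auto
  moreover have "(\<Sum>l\<le>k. card {i \<in> ?A. m i = l}) = card ?A"
    using sum.group[of ?A "{..k}" m "\<lambda>_. 1::nat"] assms(2) by auto
  \<comment> \<open>Every cluster interests at least \<open>n div R\<close> agents, so
    \<open>large\<close> provides \<open>2 * r ^ k\<close> of them for each of the
    \<open>k + 1\<close> levels.\<close>
  moreover have "Suc k * (2 * r ^ k) \<le> n div R"
    using large R by (simp add: less_eq_div_iff_mult_less_eq algebra_simps)
  ultimately show False
    using card_cluster_agents[OF assms(1)] by simp
qed

section \<open>The adversary argument for a general class of valuations\<close>

text \<open>The numerator counts one raised level of total value \<open>X\<close> per cluster. In
  the denominator, the first summand bounds what the dummy levels and the unraised level
  \<open>k\<close> pay, and each cluster level below \<open>k\<close> pays at most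
  \<open>X / r\<close> in total, whoever receives its items. Apart from validity of the algorithm,
  the class enters only through \<open>complete\<close>, which supplies shifts that lead into the
  class.\<close>

theorem distortion_lower_bound:
  assumes valid: "valid_alg n cls k qry outp"
    and complete: "\<And>u s. (\<And>i l. u i = Some l \<Longrightarrow> l \<le> k) \<Longrightarrow> (\<And>i. s i \<le> k) \<Longrightarrow>
      \<exists>y. (\<forall>i. 0 \<le> y i \<and> y i \<le> \<delta>) \<and> cls n (profile u s y)"
  shows "ereal (R * X / (n * (Suc k * \<delta>) + real R * real (Suc k) * X / r)) \<le> distortion n cls k qry outp"
proof -
  define b where "b i j = (if i < n \<and> j < n then base (level i j) else 0)" for i j
  \<comment> \<open>At most \<open>k\<close> queries cannot hit all of the \<open>k + 1\<close>
    consecutive levels from \<open>d\<close> on. This serves the cluster levels with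
    \<open>d = 0\<close> and the dummy levels with \<open>d = Suc k\<close>.\<close>
  have missed: "\<exists>l\<le>k. \<forall>j. (i, j) \<in> Q \<longrightarrow> level i j \<noteq> d + l"
    if "finite {j. (i, j) \<in> Q} \<and> card {j. (i, j) \<in> Q} \<le> k" for i d Q
  proof (rule ccontr)
    assume "\<not> ?thesis"
    then have "(\<lambda>l. d + l) ` {..k} \<subseteq> level i ` {j. (i, j) \<in> Q}" by force
    then have "card ((\<lambda>l. d + l) ` {..k}) \<le> card {j. (i, j) \<in> Q}"
      using that by (meson card_image_le card_mono finite_imageI le_trans)
    then show False using that by (simp add: card_image)
  qed
  have missed_fun: "\<exists>f. (\<forall>i. f i \<le> k) \<and> (\<forall>i j. (i, j) \<in> Q \<longrightarrow> level i j \<noteq> d + f i)"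
    if "\<And>i. finite {j. (i, j) \<in> Q} \<and> card {j. (i, j) \<in> Q} \<le> k" for d Q
    using choice[of "\<lambda>i l. l \<le> k \<and> (\<forall>j. (i, j) \<in> Q \<longrightarrow> level i j \<noteq> d + l)"] missed[OF that]
    by blast
  have agree: "profile u s y i j = b i j"
    if "u i \<noteq> Some (level i j)" "level i j \<noteq> Suc k + s i" for u s y i j
    using that by (simp add: profile_def b_def level_value_def)
  obtain Q Y where Q: "\<And>i. finite {j. (i, j) \<in> Q} \<and> card {j. (i, j) \<in> Q} \<le> k"
    and Y: "bij_betw Y {..<n} {..<n}"
    and out: "\<And>v. (\<forall>(i, j) \<in> Q. v i j = b i j) \<Longrightarrow> alg_output n k qry outp ranking v = Y"
  \<comment> \<open>While queries are answered no level is raised; shifting an unseen dummy level is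
    enough to enter the class.\<close>
  proof (rule oblivious_answers[OF valid])
    fix Q :: "(nat \<times> nat) set"
    assume Q: "\<And>i. finite {j. (i, j) \<in> Q} \<and> card {j. (i, j) \<in> Q} \<le> k"
    obtain s where s: "\<And>i. s i \<le> k" "\<And>i j. (i, j) \<in> Q \<Longrightarrow> level i j \<noteq> Suc k + s i"
      using missed_fun[OF Q, of "Suc k"] by blast
    obtain y where y: "\<forall>i. 0 \<le> y i \<and> y i \<le> \<delta>" "cls n (profile (\<lambda>_. None) s y)"
      using complete[of "\<lambda>_. None" s] s(1) by auto
    show "\<exists>v. (v, ranking) \<in> profiles n cls \<and> (\<forall>(i, j)\<in>Q. v i j = b i j)"
      using y s by (intro exI[of _ "profile (\<lambda>_. None) s y"])
        (auto simp: profiles_def intro!: consistent_ranking agree)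
  qed blast
  have Yinj: "inj_on Y {..<n}" and Yran: "Y ` {..<n} \<subseteq> {..<n}"
    using Y by (auto simp: bij_betw_def)
  obtain s where s: "\<And>i. s i \<le> k" "\<And>i j. (i, j) \<in> Q \<Longrightarrow> level i j \<noteq> Suc k + s i"
    using missed_fun[OF Q, of "Suc k"] by blast
  obtain m where m: "\<And>i. m i \<le> k" "\<And>i j. (i, j) \<in> Q \<Longrightarrow> level i j \<noteq> m i"
    using missed_fun[OF Q, of 0] by auto
  define W where "W c l = {i. i < n \<and> i mod R = c \<and> m i = l \<and> lab (Y i) \<noteq> Some (c, l)}" for c l
  have "\<forall>c. \<exists>l. c < R \<longrightarrow> l \<le> k \<and> r ^ l \<le> card (W c l)"
    unfolding W_def using popular_missed_level[of _ m Y] m(1) Yinj Yran by simp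
  from choice[OF this] obtain bl where
    bl: "\<And>c. c < R \<Longrightarrow> bl c \<le> k \<and> r ^ bl c \<le> card (W c (bl c))"
    by auto
  \<comment> \<open>Raised agents never queried the level, so the transcript stays the same, and
    their assigned item lies outside it, so the algorithm does not profit.\<close>
  define u where "u i = (if i \<in> W (i mod R) (bl (i mod R)) then Some (bl (i mod R)) else None)" for i
  have u: "l \<le> k" "l = m i" "lab (Y i) \<noteq> Some (i mod R, l)" if "u i = Some l" for i l
    using that m(1) by (auto simp: u_def W_def split: if_splits)
  obtain y where y: "\<forall>i. 0 \<le> y i \<and> y i \<le> \<delta>" and cls: "cls n (profile u s y)"
    using complete[of u s] u s(1) by blast
  define v where "v = profile u s y"
  have prof: "(v, ranking) \<in> profiles n cls"
    using y u s cls by (auto simp: v_def profiles_def intro!: consistent_ranking)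
  have outv: "alg_output n k qry outp ranking v = Y"
  proof (rule out, clarify)
    fix i j assume "(i, j) \<in> Q"
    then have "level i j \<noteq> m i" "level i j \<noteq> Suc k + s i" using s(2) m(2) by blast+
    then show "v i j = b i j"
      unfolding v_def using u(2)[of i] by (intro agree) auto
  qed
  have nonneg: "0 \<le> v i j" for i j
    using y by (simp add: v_def profile_def level_value_nonneg)

  \<comment> \<open>The agent set and its bijection onto the chosen level are packed into one pair
    so that a single use of \<open>choice\<close> yields both.\<close>
  have "\<exists>x. c < R \<longrightarrow> fst x \<subseteq> W c (bl c) \<and> card (fst x) = r ^ bl c
      \<and> bij_betw (snd x) (fst x) {j. j < n \<and> lab j = Some (c, bl c)}" for c
  proof (cases "c < R")
    case True
    obtain T where T: "T \<subseteq> W c (bl c)" "card T = r ^ bl c" "finite T"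
      using bl[OF True] by (meson obtain_subset_with_card_n)
    have "card {j. j < n \<and> lab j = Some (c, bl c)} = r ^ bl c"
      using card_lab bl True by simp
    then obtain g where "bij_betw g T {j. j < n \<and> lab j = Some (c, bl c)}"
      using finite_same_card_bij[of T "{j. j < n \<and> lab j = Some (c, bl c)}"] T by auto
    then show ?thesis using T by (intro exI[of _ "(T, g)"]) simp
  qed simp
  then have "\<forall>c. \<exists>x. c < R \<longrightarrow> fst x \<subseteq> W c (bl c) \<and> card (fst x) = r ^ bl c
      \<and> bij_betw (snd x) (fst x) {j. j < n \<and> lab j = Some (c, bl c)}" ..
  from choice[OF this] obtain x where x: "\<And>c. c < R \<Longrightarrow> fst (x c) \<subseteq> W c (bl c)
      \<and> card (fst (x c)) = r ^ bl c
      \<and> bij_betw (snd (x c)) (fst (x c)) {j. j < n \<and> lab j = Some (c, bl c)}"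
    by blast
  define T where "T c = fst (x c)" for c
  define g where "g c = snd (x c)" for c
  have T: "\<And>c. c < R \<Longrightarrow> T c \<subseteq> W c (bl c)" "\<And>c. c < R \<Longrightarrow> card (T c) = r ^ bl c"
    and g: "\<And>c. c < R \<Longrightarrow> bij_betw (g c) (T c) {j. j < n \<and> lab j = Some (c, bl c)}"
    using x by (simp_all add: T_def g_def)
  define TT where "TT = (\<Union>c<R. T c)"
  define G where "G i = g (i mod R) i" for i
  have TW: "i < n \<and> i mod R = c \<and> i \<in> W c (bl c)" if "i \<in> T c" "c < R" for i c
    using T(1)[OF that(2)] that(1) by (auto simp: W_def)
  have TTD: "i < n" "i \<in> T (i mod R)" "u i = Some (bl (i mod R))" if "i \<in> TT" for i
    using that TW unfolding TT_def u_def by auto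
  have G: "G i < n" "lab (G i) = Some (i mod R, bl (i mod R))" if "i \<in> TT" for i
    using bij_betwE[OF g[of "i mod R"]] TTD(2)[OF that] by (auto simp: G_def)
  \<comment> \<open>The label of \<open>G i\<close> determines the cluster, so a collision would
    occur within one cluster, where \<open>g\<close> is injective.\<close>
  have "inj_on G TT"
  proof (rule inj_onI)
    fix i i' assume i: "i \<in> TT" "i' \<in> TT" "G i = G i'"
    then have "i mod R = i' mod R" using G(2) by (metis option.inject prod.inject)
    then show "i = i'"
      using i TTD(2)[of i] TTD(2)[of i'] g[of "i mod R"]
      by (auto simp: G_def bij_betw_def inj_on_def)
  qed
  then have opt: "(\<Sum>i\<in>TT. v i (G i)) \<le> opt_welfare n v"
    using TTD(1) G(1) nonneg by (intro opt_welfare_ge) auto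
  have "(\<Sum>i\<in>TT. v i (G i)) = (\<Sum>i\<in>TT. X / r ^ bl (i mod R))"
  proof (rule sum.cong)
    fix i assume i: "i \<in> TT"
    have "level i (G i) = bl (i mod R)"
      using G(2)[OF i] bl by (subst level_eq_iff) auto
    then show "v i (G i) = X / r ^ bl (i mod R)"
      using TTD[OF i] G[OF i] by (simp add: v_def profile_def level_value_def)
  qed simp
  also have "\<dots> = (\<Sum>c<R. \<Sum>i\<in>T c. X / r ^ bl (i mod R))"
    unfolding TT_def
  proof (rule sum.UNION_disjoint)
    show "\<forall>c\<in>{..<R}. finite (T c)"
      using TW by (auto intro: finite_subset[of _ "{..<n}"])
    show "\<forall>c\<in>{..<R}. \<forall>d\<in>{..<R}. c \<noteq> d \<longrightarrow> T c \<inter> T d = {}"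
      using TW by blast
  qed simp
  also have "\<dots> = (\<Sum>c<R. \<Sum>i\<in>T c. X / r ^ bl c)"
    using TW by (intro sum.cong) auto
  also have "\<dots> = R * X"
    using T(2) r by simp
  finally have opt': "R * X \<le> opt_welfare n v" using opt by simp

  \<comment> \<open>A bound attached to the item instead of its receiver: since \<open>Y\<close> is
    a bijection, its sum over agents becomes a sum over items and no longer depends on the
    algorithm.\<close>
  define w where "w j = (case lab j of None \<Rightarrow> 0 | Some x \<Rightarrow>
      if fst x < R \<and> snd x < k then X / r ^ Suc (snd x) else 0)" for j
  have le: "v i (Y i) \<le> Suc k * \<delta> + w (Y i)" if "i < n" for i
  proof -
    have Yi: "Y i < n" using Yran that by auto
    define L where "L = level i (Y i)"
    have w0: "0 \<le> w (Y i)" using X by (auto simp: w_def split: option.splits)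
    \<comment> \<open>Otherwise \<open>Y i\<close> would belong to the raised level, which the
      definition of \<open>W\<close> excludes.\<close>
    have "u i \<noteq> Some L"
      using u[of i] level_eq_iff[of L i "Y i"] unfolding L_def by blast
    then have v: "v i (Y i) = (if L = Suc k + s i then base L + y i else base L)"
      using that Yi by (simp add: v_def profile_def level_value_def L_def)
    show ?thesis
    proof (cases "L < k")
      case True
      then have "lab (Y i) = Some (i mod R, L)"
        using level_eq_iff[of L i "Y i"] L_def by simp
      then have "w (Y i) = base L" using True by (simp add: w_def base_def)
      then show ?thesis using v True \<delta> by simp
    next
      case False
      have "real (2 * k + 1 - L) * \<delta> \<le> real (Suc k) * \<delta>"
        using False \<delta> by (intro mult_right_mono) auto
      \<comment> \<open>Dummy base values are at most \<open>k * \<delta>\<close>, which leaves room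
        for a shift of at most \<open>\<delta>\<close>.\<close>
      moreover have "real (2 * k + 1 - L) * \<delta> \<le> real k * \<delta>" if "L = Suc k + s i"
        using that \<delta> by (intro mult_right_mono) auto
      ultimately show ?thesis
        using v False w0 y[rule_format, of i] by (auto simp: base_def algebra_simps)
    qed
  qed
  have "social_welfare n v Y \<le> (\<Sum>i<n. Suc k * \<delta> + w (Y i))"
    unfolding social_welfare_def using le by (intro sum_mono) auto
  also have "\<dots> = n * (Suc k * \<delta>) + (\<Sum>i<n. w (Y i))"
    by (simp add: sum.distrib)
  also have "(\<Sum>i<n. w (Y i)) = (\<Sum>j<n. w j)"
    by (rule sum.reindex_bij_betw[OF Y])
  also have "\<dots> = (\<Sum>x\<in>{..R} \<times> {..k}. card {j. j < n \<and> lab j = Some x} *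
      (if fst x < R \<and> snd x < k then X / r ^ Suc (snd x) else 0))"
    unfolding w_def by (intro sum_over_labels lab_range) auto
  \<comment> \<open>Level \<open>l < k\<close> of a cluster consists of \<open>r ^ l\<close> items
    worth \<open>X / r ^ Suc l\<close> each.\<close>
  also have "\<dots> = (\<Sum>x\<in>{..R} \<times> {..k}. if x \<in> {..<R} \<times> {..<k} then X / r else 0)"
    using r by (intro sum.cong) (auto simp: card_lab)
  also have "\<dots> = (\<Sum>x\<in>{..<R} \<times> {..<k}. X / r)"
    by (subst sum.mono_neutral_cong_right[of _ "{..<R} \<times> {..<k}"]) auto
  also have "\<dots> = R * k * X / r" by (simp add: card_cartesian_product)
  also have "\<dots> \<le> real R * real (Suc k) * X / r"
    using X by (intro divide_right_mono mult_right_mono) (auto simp: algebra_simps)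
  finally show ?thesis
    using prof opt' outv R X nonneg
    by (intro distortion_ge[of v ranking]) (auto simp: social_welfare_def intro!: sum_nonneg)
qed

section \<open>Row sums, needed for the unit-sum normalisation\<close>

text \<open>The row sum is affine in \<open>y i\<close> with slope \<open>h\<close>, the size of a
  dummy level. Raising level \<open>l\<close> lifts its total to \<open>X\<close>, so the last term
  is the additional mass that the shift has to compensate.\<close>

lemma sum_profile:
  fixes y :: "nat \<Rightarrow> real"
  assumes "i < n" "s i \<le> k" "\<And>l. u i = Some l \<Longrightarrow> l \<le> k"
  shows "(\<Sum>j<n. profile u s y i j)
    = (\<Sum>l\<le>k. r ^ l * base l) + (\<Sum>l\<le>k. h * base (Suc k + l)) + h * y i
      + (case u i of None \<Rightarrow> 0 | Some l \<Rightarrow> X - r ^ l * base l)"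
proof -
  let ?f = "level_value (u i) (s i) (y i)"
  let ?F = "\<lambda>(c, l). if c = i mod R then ?f l else if c = R then ?f (Suc k + l) else 0"
  have end0: "?f (2 * k + 2) = 0"
    using assms(2,3) by (auto simp: level_value_def base_def)
  have "(\<Sum>j<n. profile u s y i j) = (\<Sum>j<n. case lab j of Some x \<Rightarrow> ?F x | None \<Rightarrow> 0)"
    using assms(1) end0
    by (intro sum.cong) (auto simp: profile_def level_def split: option.splits)
  also have "\<dots> = (\<Sum>x\<in>{..R} \<times> {..k}. card {j. j < n \<and> lab j = Some x} * ?F x)"
    by (intro sum_over_labels lab_range) auto
  also have "\<dots> = (\<Sum>c\<le>R. \<Sum>l\<le>k. card {j. j < n \<and> lab j = Some (c, l)} * ?F (c, l))"
    by (subst sum.cartesian_product) (auto intro!: sum.cong)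
  also have "\<dots> = (\<Sum>c\<in>{i mod R, R}. \<Sum>l\<le>k. card {j. j < n \<and> lab j = Some (c, l)} * ?F (c, l))"
    by (rule sum.mono_neutral_right) (auto simp: less_imp_le)
  also have "\<dots> = (\<Sum>l\<le>k. r ^ l * ?f l) + (\<Sum>l\<le>k. h * ?f (Suc k + l))"
    using mod_R_less[of i] by (simp add: card_lab less_imp_le less_imp_neq[OF mod_R_less]
        less_imp_neq[OF mod_R_less, symmetric])
  also have "(\<Sum>l\<le>k. h * ?f (Suc k + l)) = (\<Sum>l\<le>k. h * base (Suc k + l) + (if l = s i then h * y i else 0))"
    using assms(3) by (intro sum.cong) (force simp: level_value_def algebra_simps)+
  also have "\<dots> = (\<Sum>l\<le>k. h * base (Suc k + l)) + h * y i"
    using assms(2) by (simp add: sum.distrib)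
  also have "(\<Sum>l\<le>k. r ^ l * ?f l)
      = (\<Sum>l\<le>k. r ^ l * base l + (if u i = Some l then X - r ^ l * base l else 0))"
    using r by (intro sum.cong) (auto simp: level_value_def)
  also have "\<dots> = (\<Sum>l\<le>k. r ^ l * base l) + (case u i of None \<Rightarrow> 0 | Some l \<Rightarrow> X - r ^ l * base l)"
    using assms(3) by (cases "u i") (auto simp: sum.distrib)
  finally show ?thesis by simp
qed

lemma boosted_mass_nonneg: "l \<le> k \<Longrightarrow> 0 \<le> X - r ^ l * base l"
proof -
  assume "l \<le> k"
  have r1: "1 \<le> real r" using r by simp
  show ?thesis
  proof (cases "l < k")
    case True
    then show ?thesis using r1 X by (simp add: base_def field_simps)
  next
    case False
    then have "l = k" "2 * k + 1 - k = Suc k" using \<open>l \<le> k\<close> by auto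
    then show ?thesis using tail r1 by (simp add: base_def field_simps)
  qed
qed

end

section \<open>The instances for unrestricted and for unit-sum valuations\<close>

text \<open>The clusters take at most one half of the items and the dummy levels at most the other
  half.\<close>

lemma level_labelling_exists:
  assumes "2 * Suc k * R * r ^ k \<le> n" "2 * Suc k * h \<le> n" "1 \<le> (r::nat)"
  obtains lab :: "nat \<Rightarrow> (nat \<times> nat) option" where
    "\<And>j x. lab j = Some x \<Longrightarrow> x \<in> {..R} \<times> {..k}"
    "\<And>c l. c \<le> R \<Longrightarrow> l \<le> k \<Longrightarrow>
      card {j. j < n \<and> lab j = Some (c, l)} = (if c < R then r ^ l else h)"
proof -
  let ?f = "\<lambda>(c, l). if c < R then r ^ l else h"
  have "sum ?f ({..R} \<times> {..k}) = (\<Sum>c\<le>R. \<Sum>l\<le>k. if c < R then r ^ l else h)"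
    by (simp add: sum.cartesian_product)
  also have "\<dots> = (\<Sum>c<R. \<Sum>l\<le>k. if c < R then r ^ l else h) + Suc k * h"
    by (simp flip: lessThan_Suc_atMost)
  also have "(\<Sum>c<R. \<Sum>l\<le>k. if c < R then r ^ l else h) \<le> (\<Sum>c<R. \<Sum>l\<le>k. r ^ k)"
    using assms(3) by (intro sum_mono) (auto intro: power_increasing)
  also have "(\<Sum>c<R. \<Sum>l\<le>k. r ^ k) + Suc k * h \<le> n"
    using assms(1,2) by (simp add: algebra_simps)
  finally have "sum ?f ({..R} \<times> {..k}) \<le> n" by simp
  then obtain lab :: "nat \<Rightarrow> (nat \<times> nat) option" where
    "\<And>j x. lab j = Some x \<Longrightarrow> x \<in> {..R} \<times> {..k}"
    "\<And>x. x \<in> {..R} \<times> {..k} \<Longrightarrow> card {j. j < n \<and> lab j = Some x} = ?f x"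
    by (rule labelling_exists[rotated]) auto
  then show ?thesis by (intro that[of lab]) auto
qed

text \<open>One cluster with \<open>X = 1\<close> suffices; without normalisation the dummy levels
  are empty and \<open>\<delta> = 0\<close>, so only the terms \<open>X / r\<close> remain in the
  algorithm's bound.\<close>

lemma distortion_unrestricted_ge:
  assumes valid: "valid_alg n unrestricted_val k qry outp"
    and r: "1 \<le> r" and n: "2 * Suc k * r ^ k \<le> n"
  shows "ereal (r / Suc k) \<le> distortion n unrestricted_val k qry outp"
proof -
  define R :: nat where "R = 1"
  have R: "1 \<le> R" and n': "2 * Suc k * R * r ^ k \<le> n" and h: "2 * Suc k * 0 \<le> n"
    using n by (simp_all add: R_def)
  obtain lab where lab: "\<And>j x. lab j = Some x \<Longrightarrow> x \<in> {..R} \<times> {..k}"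
    "\<And>c l. c \<le> R \<Longrightarrow> l \<le> k \<Longrightarrow>
      card {j. j < n \<and> lab j = Some (c, l)} = (if c < R then r ^ l else 0)"
    using level_labelling_exists[OF n' h r] by blast
  interpret level_instance n k r R 0 1 0 lab
    by unfold_locales (use r R n' lab in simp_all)
  have "ereal (real R * 1 / (real n * (real (Suc k) * 0) + real R * real (Suc k) * 1 / r))
      \<le> distortion n unrestricted_val k qry outp"
  proof (rule distortion_lower_bound[OF valid])
    fix u s
    have "unrestricted_val n (profile u s (\<lambda>_. 0))"
      by (auto simp: unrestricted_val_def profile_def level_value_nonneg)
    then show "\<exists>y. (\<forall>i. 0 \<le> y i \<and> y i \<le> 0) \<and> unrestricted_val n (profile u s y)"
      by (intro exI[of _ "\<lambda>_. 0"]) auto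
  qed
  then show ?thesis by (simp add: R_def)
qed

text \<open>With \<open>r\<close> clusters and \<open>X = h * \<delta>\<close> the optimum is at
  least \<open>r * h * \<delta>\<close>. Since \<open>n \<le> 4 * Suc k * h\<close>, the small
  values earn the algorithm at most four times \<open>(Suc k)\<^sup>2 * h * \<delta>\<close>, and
  the cluster levels at most once that amount; hence the factor 5.\<close>

lemma distortion_unit_sum_ge:
  assumes valid: "valid_alg n unit_sum_val k qry outp"
    and r: "1 \<le> r" and n: "2 * (Suc k)\<^sup>2 * r ^ Suc k \<le> n"
  shows "ereal (r / (5 * (Suc k)\<^sup>2)) \<le> distortion n unit_sum_val k qry outp"
proof -
  define h where "h = n div (2 * Suc k)"
  have "Suc k * r ^ Suc k \<le> h"
    unfolding h_def using n
    by (subst less_eq_div_iff_mult_less_eq) (auto simp: power2_eq_square algebra_simps)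
  moreover have "1 * (Suc k * r ^ k) \<le> r * (Suc k * r ^ k)"
    using r by (intro mult_right_mono) auto
  \<comment> \<open>For \<open>X = h * \<delta>\<close> this is the condition
    \<open>tail\<close>.\<close>
  ultimately have h: "Suc k * r ^ k \<le> h" by (simp add: algebra_simps)
  have "1 \<le> Suc k * r ^ k" using r by (simp add: Suc_le_eq)
  then have h1: "1 \<le> h" using h by linarith
  have hn: "2 * Suc k * h \<le> n" unfolding h_def by (rule times_div_less_eq_dividend)
  \<comment> \<open>Because \<open>h\<close> is at least 1, rounding it down costs no more than a
    factor of 2.\<close>
  have "n < 2 * Suc k * h + 2 * Suc k"
    unfolding h_def using dividend_less_times_div[of "2 * Suc k" n] by simp
  also have "\<dots> \<le> 2 * Suc k * h + 2 * Suc k * h"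
    using h1 by (intro add_left_mono) (metis mult.right_neutral mult_le_mono2)
  finally have n4: "n \<le> 4 * Suc k * h" by (simp add: algebra_simps)
  have "1 * (2 * Suc k * r ^ Suc k) \<le> Suc k * (2 * Suc k * r ^ Suc k)"
    by (intro mult_right_mono) auto
  then have n': "2 * Suc k * r * r ^ k \<le> n"
    using n by (simp add: power2_eq_square algebra_simps)
  obtain lab where lab: "\<And>j x. lab j = Some x \<Longrightarrow> x \<in> {..r} \<times> {..k}"
    "\<And>c l. c \<le> r \<Longrightarrow> l \<le> k \<Longrightarrow>
      card {j. j < n \<and> lab j = Some (c, l)} = (if c < r then r ^ l else h)"
    using level_labelling_exists[OF n' hn r] by blast
  txt \<open>\<open>\<delta>\<close> is chosen such that the answers have total mass \<open>1 - X\<close> with \<open>X = h * \<delta>\<close>, the largest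
    amount that one dummy level can absorb.\<close>
  define D where "D = k * h / r + r ^ k * Suc k + h * (\<Sum>l\<le>k. real (k - l)) + h"
  define \<delta> where "\<delta> = 1 / D"
  have D: "0 < D" unfolding D_def using h1
    by (intro add_nonneg_pos add_nonneg_nonneg mult_nonneg_nonneg sum_nonneg) auto
  have pos: "0 < \<delta>" using D by (simp add: \<delta>_def)
  have tail: "Suc k * \<delta> \<le> h * \<delta> / r ^ k"
  proof -
    have "real (Suc k * r ^ k) * \<delta> \<le> real h * \<delta>"
      using h pos by (intro mult_right_mono) (auto simp only: of_nat_le_iff less_imp_le)
    then show ?thesis using r by (simp add: field_simps)
  qed
  interpret level_instance n k r r h "h * \<delta>" \<delta> lab
    by unfold_locales (use r n' tail pos h1 lab in simp_all)
  \<comment> \<open>Multiplied by \<open>\<delta>\<close>, the first three summands of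
    \<open>D\<close> are the masses of the cluster levels below \<open>k\<close>, of level
    \<open>k\<close> and of the dummy levels; the last summand \<open>h\<close> is the reserve for
    the shift.\<close>
  have mass: "(\<Sum>l\<le>k. r ^ l * base l) + (\<Sum>l\<le>k. h * base (Suc k + l)) = 1 - h * \<delta>"
  proof -
    have "(\<Sum>l\<le>k. r ^ l * base l) = (\<Sum>l<k. r ^ l * base l) + r ^ k * base k"
      by (simp flip: lessThan_Suc_atMost)
    also have "(\<Sum>l<k. r ^ l * base l) = (\<Sum>l<k. h * \<delta> / r)"
      using r by (intro sum.cong) (auto simp: base_def)
    also have "base k = Suc k * \<delta>"
    proof -
      have "2 * k + 1 - k = Suc k" by simp
      then show ?thesis by (simp add: base_def)
    qed
    finally have 1: "(\<Sum>l\<le>k. r ^ l * base l) = k * (h * \<delta> / r) + r ^ k * (Suc k * \<delta>)" by simp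
    have "(\<Sum>l\<le>k. h * base (Suc k + l)) = (\<Sum>l\<le>k. h * \<delta> * real (k - l))"
      by (intro sum.cong) (auto simp: base_def)
    also have "\<dots> = h * \<delta> * (\<Sum>l\<le>k. real (k - l))"
      by (rule sum_distrib_left[symmetric])
    finally have "(\<Sum>l\<le>k. r ^ l * base l) + (\<Sum>l\<le>k. h * base (Suc k + l)) + h * \<delta> = D * \<delta>"
      unfolding 1 D_def by (simp add: algebra_simps)
    also have "\<dots> = 1" using D by (simp add: \<delta>_def)
    finally show ?thesis by simp
  qed
  have bound: "ereal (r * (h * \<delta>) / (n * (Suc k * \<delta>) + real r * real (Suc k) * (h * \<delta>) / r))
      \<le> distortion n unit_sum_val k qry outp"
  proof (rule distortion_lower_bound[OF valid])
    fix u :: "nat \<Rightarrow> nat option" and s :: "nat \<Rightarrow> nat"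
    assume u: "\<And>i l. u i = Some l \<Longrightarrow> l \<le> k" and s: "\<And>i. s i \<le> k"
    \<comment> \<open>\<open>e i\<close> is the mass added by raising. It is at most
      \<open>h * \<delta>\<close>, so lowering the full shift \<open>\<delta>\<close> by
      \<open>e i / h\<close> on all \<open>h\<close> items stays inside the window and gives row sum
      1.\<close>
    define e where "e i = (case u i of None \<Rightarrow> 0 | Some l \<Rightarrow> h * \<delta> - r ^ l * base l)" for i
    define y where "y i = \<delta> - e i / h" for i
    have e: "0 \<le> e i" "e i \<le> h * \<delta>" for i
      using u[of i] boosted_mass_nonneg base_nonneg pos
      by (auto simp: e_def split: option.splits)
    have y: "0 \<le> y i \<and> y i \<le> \<delta>" for i
      using e[of i] h1 by (simp add: y_def field_simps)
    have "(\<Sum>j<n. profile u s y i j) = 1" if "i < n" for i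
    proof -
      have "(\<Sum>j<n. profile u s y i j) = 1 - h * \<delta> + h * y i + e i"
        using sum_profile[of i s u y] that s u mass by (simp add: e_def)
      also have "\<dots> = 1" using h1 by (simp add: y_def field_simps)
      finally show ?thesis .
    qed
    then have "unit_sum_val n (profile u s y)"
      using y by (auto simp: unit_sum_val_def unrestricted_val_def profile_def level_value_nonneg)
    with y show "\<exists>y. (\<forall>i. 0 \<le> y i \<and> y i \<le> \<delta>) \<and> unit_sum_val n (profile u s y)" by blast
  qed
  have "r / (5 * (Suc k)\<^sup>2) = r * (h * \<delta>) / (5 * (real (Suc k))\<^sup>2 * (h * \<delta>))"
    using h1 pos by (simp del: of_nat_Suc)
  also have "\<dots> \<le> r * (h * \<delta>) / (n * (Suc k * \<delta>) + real r * real (Suc k) * (h * \<delta>) / r)"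
  proof (rule divide_left_mono)
    define p where "p = real (Suc k)"
    have "1 \<le> p" by (simp add: p_def)
    have "real n \<le> 4 * p * h"
      using n4 unfolding p_def by (metis of_nat_le_iff of_nat_mult of_nat_numeral)
    then have "real n * (p * \<delta>) \<le> 4 * p * h * (p * \<delta>)"
      using pos \<open>1 \<le> p\<close> by (intro mult_right_mono) auto
    moreover have "1 * (p * (h * \<delta>)) \<le> p * (p * (h * \<delta>))"
      using pos \<open>1 \<le> p\<close> by (intro mult_right_mono) auto
    moreover have "r * p * (h * \<delta>) / r = p * (h * \<delta>)" using r by simp
    ultimately have "n * (p * \<delta>) + r * p * (h * \<delta>) / r \<le> 5 * p\<^sup>2 * (h * \<delta>)"
      by (simp add: power2_eq_square algebra_simps)
    then show "n * (Suc k * \<delta>) + real r * real (Suc k) * (h * \<delta>) / r \<le> 5 * (real (Suc k))\<^sup>2 * (h * \<delta>)"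
      unfolding p_def .
    show "0 \<le> r * (h * \<delta>)" using pos by simp
    show "0 < 5 * (real (Suc k))\<^sup>2 * (h * \<delta>) * (n * (Suc k * \<delta>) + real r * real (Suc k) * (h * \<delta>) / r)"
      using pos h1 r by (intro mult_pos_pos add_nonneg_pos) auto
  qed
  finally show ?thesis using bound order_trans by (metis ereal_less_eq(3))
qed

section \<open>Choice of \<open>r\<close> and the asymptotic bounds\<close>

text \<open>Take \<open>r\<close> to be the \<open>p\<close>-th root of \<open>n / a\<close>,
  rounded down; as the root is at least 1, rounding loses at most a factor of 2.\<close>

lemma nat_root_choice:
  assumes "1 \<le> p" "1 \<le> a" "a \<le> n"
  obtains r :: nat where "1 \<le> r" "a * r ^ p \<le> n"
    "(1 / real a) powr (1 / p) / 2 * real n powr (1 / p) \<le> r"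
proof -
  define x where "x = (real n / a) powr (1 / p)"
  have x1: "1 \<le> x"
    unfolding x_def using assms by (intro ge_one_powr_ge_zero) auto
  have r1: "1 \<le> nat \<lfloor>x\<rfloor>" using x1 by linarith
  moreover have "a * nat \<lfloor>x\<rfloor> ^ p \<le> n"
  proof -
    have "real (nat \<lfloor>x\<rfloor>) ^ p \<le> x ^ p"
      using x1 by (intro power_mono) auto
    also have "\<dots> = x powr p"
      using x1 by (simp add: powr_realpow)
    also have "\<dots> = real n / a"
      using assms by (simp add: x_def powr_powr)
    finally have "real (a * nat \<lfloor>x\<rfloor> ^ p) \<le> real n"
      using assms by (simp add: field_simps)
    then show ?thesis by linarith
  qed
  moreover have "(1 / real a) powr (1 / p) / 2 * real n powr (1 / p) = x / 2"
    unfolding x_def using assms by (subst powr_divide, simp, simp) (simp add: powr_divide)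
  moreover have "x / 2 \<le> nat \<lfloor>x\<rfloor>" using r1 by linarith
  ultimately show ?thesis using that[of "nat \<lfloor>x\<rfloor>"] by simp
qed

lemma unrestricted_constant_queries:
  assumes "1 \<le> k"
  shows "\<exists>c>0. \<exists>n0. \<forall>n\<ge>n0. \<forall>qry outp. valid_alg n unrestricted_val k qry outp \<longrightarrow>
    distortion n unrestricted_val k qry outp \<ge> ereal (c * real n powr (1 / real k))"
proof (intro exI conjI allI impI)
  let ?a = "2 * Suc k"
  let ?c = "(1 / real ?a) powr (1 / k) / 2 / Suc k"
  show "0 < ?c" by simp
  fix n qry outp
  assume n: "?a \<le> n" and valid: "valid_alg n unrestricted_val k qry outp"
  obtain r where r: "1 \<le> r" "?a * r ^ k \<le> n"
    "(1 / real ?a) powr (1 / k) / 2 * real n powr (1 / k) \<le> r"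
    using nat_root_choice[of k ?a n] assms n by auto
  have "?c * real n powr (1 / k) = (1 / real ?a) powr (1 / k) / 2 * real n powr (1 / k) / Suc k"
    by simp
  also have "\<dots> \<le> r / Suc k" by (rule divide_right_mono[OF r(3)]) simp
  finally have "ereal (?c * real n powr (1 / k)) \<le> ereal (r / Suc k)" by simp
  also have "\<dots> \<le> distortion n unrestricted_val k qry outp"
    by (rule distortion_unrestricted_ge[OF valid r(1,2)])
  finally show "ereal (?c * real n powr (1 / k)) \<le> distortion n unrestricted_val k qry outp" .
qed

lemma unit_sum_constant_queries:
  "\<exists>c>0. \<exists>n0. \<forall>n\<ge>n0. \<forall>qry outp. valid_alg n unit_sum_val k qry outp \<longrightarrow>
    distortion n unit_sum_val k qry outp \<ge> ereal (c * real n powr (1 / real (k + 1)))"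
proof (intro exI conjI allI impI)
  let ?a = "2 * (Suc k)\<^sup>2"
  let ?p = "1 / real (k + 1)"
  let ?c = "(1 / real ?a) powr ?p / 2 / (5 * (Suc k)\<^sup>2)"
  show "0 < ?c" by simp
  fix n qry outp
  assume n: "?a \<le> n" and valid: "valid_alg n unit_sum_val k qry outp"
  have "1 \<le> ?a" by simp
  then obtain r where r: "1 \<le> r" "?a * r ^ Suc k \<le> n"
    "(1 / real ?a) powr ?p / 2 * real n powr ?p \<le> r"
    using nat_root_choice[of "k + 1" ?a n] n by (metis Suc_eq_plus1 le_add2)
  have "?c * real n powr ?p = (1 / real ?a) powr ?p / 2 * real n powr ?p / (5 * (Suc k)\<^sup>2)"
    by simp
  also have "\<dots> \<le> r / (5 * (Suc k)\<^sup>2)" by (rule divide_right_mono[OF r(3)]) simp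
  finally have "ereal (?c * real n powr ?p) \<le> ereal (r / (5 * (Suc k)\<^sup>2))" by simp
  also have "\<dots> \<le> distortion n unit_sum_val k qry outp"
    by (rule distortion_unit_sum_ge[OF valid r(1,2)])
  finally show "ereal (?c * real n powr ?p) \<le> distortion n unit_sum_val k qry outp" .
qed

text \<open>Take \<open>r\<close> close to \<open>ln n\<close> to the fourth power. As
  \<open>Suc (q n)\<close> is eventually at most \<open>ln n\<close>, both lower bounds are at least
  about \<open>ln n\<close> squared over 5, which exceeds every multiple of
  \<open>ln (ln n)\<close>.\<close>

lemma sublogarithmic_queries:
  assumes q: "(\<lambda>n. real (q n)) \<in> o(\<lambda>n. ln (real n) / ln (ln (real n)))"
    and cls: "cls \<in> {unrestricted_val, unit_sum_val}"
  shows "\<exists>n0. \<forall>n\<ge>n0. \<forall>qry outp. valid_alg n cls (q n) qry outp \<longrightarrow>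
    distortion n cls (q n) qry outp \<ge> ereal (C * ln (ln (real n)))"
proof -
  have "\<forall>\<^sub>F n in sequentially. norm (real (q n)) \<le> 1/8 * norm (ln (real n) / ln (ln (real n)))"
    using landau_o.smallD[OF q, of "1/8"] by simp
  moreover have "\<forall>\<^sub>F n::nat in sequentially. 1 < ln (ln (real n))" by real_asymp
  moreover have "\<forall>\<^sub>F n::nat in sequentially. 1 < ln (real n)" by real_asymp
  moreover have "\<forall>\<^sub>F n::nat in sequentially.
      C * ln (ln (real n)) \<le> ((ln (real n)) ^ 4 - 1) / (5 * (ln (real n))\<^sup>2)" by real_asymp
  moreover have "\<forall>\<^sub>F n::nat in sequentially.
      2 * (ln (real n))\<^sup>2 * exp (4 * ln (ln (real n)) + ln (real n) / 2) \<le> real n" by real_asymp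
  moreover have "\<forall>\<^sub>F n::nat in sequentially. ln (real n) / 8 + 1 \<le> ln (real n)" by real_asymp
  ultimately have "\<forall>\<^sub>F n in sequentially. \<forall>qry outp. valid_alg n cls (q n) qry outp \<longrightarrow>
    distortion n cls (q n) qry outp \<ge> ereal (C * ln (ln (real n)))"
  proof eventually_elim
    case (elim n)
    let ?L = "ln (real n)" and ?M = "ln (ln (real n))"
    \<comment> \<open>The constant 1/8 makes \<open>r ^ Suc (q n)\<close> at most the square root of
      \<open>n\<close> times a power of \<open>ln n\<close>, which leaves room for the remaining
      factors in the size condition.\<close>
    have qM: "q n * ?M \<le> ?L / 8" using elim(1-3) by (simp add: field_simps)
    have "real (q n) * 1 \<le> q n * ?M" using elim(2) by (intro mult_left_mono) auto
    then have p: "real (Suc (q n)) \<le> ?L" using qM elim(6) by simp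
    define r where "r = nat \<lfloor>?L ^ 4\<rfloor>"
    have "1 \<le> ?L ^ 4" using elim(3) by (intro one_le_power) auto
    then have r: "1 \<le> r" "real r \<le> ?L ^ 4" "?L ^ 4 - 1 \<le> real r"
      unfolding r_def by linarith+
    have "real r ^ Suc (q n) \<le> (?L ^ 4) ^ Suc (q n)"
      using r by (intro power_mono) auto
    also have "\<dots> = exp (?M) ^ (4 * Suc (q n))"
      using elim(3) by (simp only: power_mult exp_ln[of ?L])
    also have "\<dots> = exp (4 * ?M + 4 * (q n * ?M))"
      by (simp flip: exp_of_nat_mult add: algebra_simps)
    also have "\<dots> \<le> exp (4 * ?M + ?L / 2)" using qM by simp
    finally have "2 * (real (Suc (q n)))\<^sup>2 * real r ^ Suc (q n) \<le> 2 * ?L\<^sup>2 * exp (4 * ?M + ?L / 2)"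
      using p by (intro mult_mono power_mono) auto
    also have "\<dots> \<le> real n" by (rule elim(5))
    finally have "real (2 * (Suc (q n))\<^sup>2 * r ^ Suc (q n)) \<le> real n" by simp
    then have n: "2 * (Suc (q n))\<^sup>2 * r ^ Suc (q n) \<le> n" by (simp only: of_nat_le_iff)
    have "2 * Suc (q n) * r ^ q n \<le> 2 * (Suc (q n))\<^sup>2 * r ^ Suc (q n)"
      using r(1) by (intro mult_mono power_increasing) (auto simp: power2_eq_square)
    with n have n': "2 * Suc (q n) * r ^ q n \<le> n" by linarith
    have "C * ?M \<le> (?L ^ 4 - 1) / (5 * ?L\<^sup>2)" by (rule elim(4))
    also have "\<dots> \<le> r / (5 * (real (Suc (q n)))\<^sup>2)"
      using r p \<open>1 \<le> ?L ^ 4\<close> by (intro frac_le mult_left_mono power_mono) auto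
    finally have Cr: "C * ?M \<le> r / (5 * (Suc (q n))\<^sup>2)" by simp
    have "real (Suc (q n)) * 1 \<le> real (Suc (q n)) * (5 * real (Suc (q n)))"
      by (intro mult_left_mono) auto
    then have "r / (5 * (real (Suc (q n)))\<^sup>2) \<le> r / Suc (q n)"
      by (intro divide_left_mono) (auto simp: power2_eq_square algebra_simps simp del: of_nat_Suc)
    then have Cr': "C * ?M \<le> r / Suc (q n)" using Cr by simp
    show ?case
    proof (intro allI impI)
      fix qry outp
      assume valid: "valid_alg n cls (q n) qry outp"
      show "ereal (C * ?M) \<le> distortion n cls (q n) qry outp"
        using cls
      proof (elim insertE emptyE)
        assume "cls = unrestricted_val"
        then show ?thesis
          using distortion_unrestricted_ge[OF _ r(1) n'] valid Cr' by (meson ereal_less_eq(3) order_trans)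
      next
        assume "cls = unit_sum_val"
        then show ?thesis
          using distortion_unit_sum_ge[OF _ r(1) n] valid Cr by (meson ereal_less_eq(3) order_trans)
      qed
    qed
  qed
  then show ?thesis by (simp add: eventually_sequentially)
qed

theorem mainTheorem8:
  shows "(\<forall>k::nat. k \<ge> 1 \<longrightarrow>
           (\<exists>c>0. \<exists>n0. \<forall>n\<ge>n0. \<forall>qry outp. valid_alg n unrestricted_val k qry outp \<longrightarrow>
               distortion n unrestricted_val k qry outp \<ge> ereal (c * real n powr (1 / real k)))
         \<and> (\<exists>c>0. \<exists>n0. \<forall>n\<ge>n0. \<forall>qry outp. valid_alg n unit_sum_val k qry outp \<longrightarrow>
               distortion n unit_sum_val k qry outp \<ge> ereal (c * real n powr (1 / real (k + 1)))))
       \<and> (\<forall>q::nat \<Rightarrow> nat. (\<lambda>n. real (q n)) \<in> o(\<lambda>n. ln (real n) / ln (ln (real n))) \<longrightarrow>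
           (\<forall>cls \<in> {unrestricted_val, unit_sum_val}.
             \<forall>C>0. \<exists>n0. \<forall>n\<ge>n0. \<forall>qry outp. valid_alg n cls (q n) qry outp \<longrightarrow>
               distortion n cls (q n) qry outp \<ge> ereal (C * ln (ln (real n)))))"
  by (intro conjI allI impI ballI)
    (rule unrestricted_constant_queries unit_sum_constant_queries sublogarithmic_queries;
      assumption)+

end
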